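(* Let $t \in (0, 3/2]$ be a real number and let $G$ be a minimally $t$-tough graph with a universal vertex. Then one of the following holds: (1) $t\le 1/2$ and $G \cong K_{1,\ell}$ for some integer $\ell \geq 2$; or (2) $t>1$ and $G \cong W_{\ell}$ for some integer $\ell \geq 5$.
   Context: All graphs are finite, simple, and undirected. A universal vertex is a vertex adjacent to all other vertices of the graph. For a graph $H$, $c(H)$ denotes the number of connected components of $H$. A set $S\subseteq V(G)$ is a separator of $G$ if $c(G-S)\ge 2$. The toughness $\tau(G)$ of a graph $G$ is the minimum of $|S|/c(G-S)$ over all separators $S$ of $G$, with $\tau(G)=\infty$ if $G$ has no separators, that is, if $G$ is complete. A graph $G$ is minimally $t$-tough if $\tau(G)=t$ and $\tau(G-e)<t$ for every edge $e$ of $G$. $K_{1,\ell}$ is the star with $\ell$ leaves. For an integer $\ell\ge 5$, the wheel $W_\ell$ is the join of $K_1$ and the cycle $C_{\ell-1}$ (the cycle on $\ell-1$ vertices plus one new vertex adjacent to all vertices of the cycle). *)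

theory Defs
  imports "Graph_Theory.Graph_Theory" "HOL-Library.Extended_Real"
begin

text \<open>
  A finite simple undirected graph is a \<^const>\<open>pair_graph\<close>: a finite, loop-free, symmetric
  digraph without parallel arcs, so that an undirected edge \<open>uv\<close> is the pair of arcs \<open>(u,v)\<close>, \<open>(v,u)\<close>.
\<close>

definition universal_vertex :: "'a pair_pre_digraph \<Rightarrow> 'a \<Rightarrow> bool" where
  "universal_vertex G v \<longleftrightarrow> v \<in> pverts G \<and> (\<forall>u \<in> pverts G - {v}. (v, u) \<in> parcs G)"

definition delete_edge :: "'a pair_pre_digraph \<Rightarrow> 'a \<Rightarrow> 'a \<Rightarrow> 'a pair_pre_digraph" where
  "delete_edge G u v = \<lparr> pverts = pverts G, parcs = parcs G - {(u, v), (v, u)} \<rparr>"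

text \<open>In a symmetric digraph the strongly connected components are the connected components.\<close>

definition num_components :: "('a, 'b) pre_digraph \<Rightarrow> nat" where
  "num_components H = card (pre_digraph.sccs H)"

definition components_without :: "'a pair_pre_digraph \<Rightarrow> 'a set \<Rightarrow> nat" where
  "components_without G S = num_components (with_proj G \<restriction> (pverts G - S))"

definition separators :: "'a pair_pre_digraph \<Rightarrow> 'a set set" where
  "separators G = {S. S \<subseteq> pverts G \<and> components_without G S \<ge> 2}"

text \<open>The minimum is over a finite set whenever \<open>G\<close> is finite.\<close>

definition toughness :: "'a pair_pre_digraph \<Rightarrow> ereal" where
  "toughness G =
    (if separators G = {} then \<infinity>
     else ereal (Min ((\<lambda>S. real (card S) / real (components_without G S)) ` separators G)))"

definition minimally_tough :: "real \<Rightarrow> 'a pair_pre_digraph \<Rightarrow> bool" where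
  "minimally_tough t G \<longleftrightarrow>
    toughness G = ereal t \<and>
    (\<forall>(u, v) \<in> parcs G. toughness (delete_edge G u v) < ereal t)"

definition graph_join :: "'a pair_pre_digraph \<Rightarrow> 'b pair_pre_digraph \<Rightarrow> ('a + 'b) pair_pre_digraph" where
  "graph_join G H =
    \<lparr> pverts = pverts G <+> pverts H,
      parcs = map_prod Inl Inl ` parcs G \<union> map_prod Inr Inr ` parcs H \<union>
        Inl ` pverts G \<times> Inr ` pverts H \<union> Inr ` pverts H \<times> Inl ` pverts G \<rparr>"

text \<open>This is the simple cycle on \<open>n\<close> vertices only for \<open>n \<ge> 3\<close>.\<close>

definition cycle_graph :: "nat \<Rightarrow> nat pair_pre_digraph" where
  "cycle_graph n =
    \<lparr> pverts = {..<n},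
      parcs = {(i, j). i < n \<and> j < n \<and> (j = (i + 1) mod n \<or> i = (j + 1) mod n)} \<rparr>"

text \<open>The index counts all vertices, including the hub.\<close>

definition wheel_graph :: "nat \<Rightarrow> (unit + nat) pair_pre_digraph" where
  "wheel_graph l = graph_join \<lparr> pverts = {()}, parcs = {} \<rparr> (cycle_graph (l - 1))"

end

theory Submission
  imports Defs
begin

text \<open>
  Fix a universal vertex \<open>u\<close>. Everything rests on pinning down the degree of each \<open>y \<noteq> u\<close>.

  From above: deleting the edge \<open>uy\<close> must lower the toughness, so some separator \<open>S\<close> of \<open>G - uy\<close> has
  \<open>\<bar>S\<bar> < t c(G - uy - S)\<close>. If \<open>S\<close> contained \<open>u\<close> or \<open>y\<close>, it would leave the same graph behind
  in \<open>G\<close>, which has toughness \<open>t\<close>. So both survive, every surviving vertex other than \<open>y\<close> hangs on \<open>u\<close>,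
  and there are two components only because \<open>y\<close> is isolated. Hence \<open>\<bar>S\<bar> < 2t\<close>, all neighbours
  of \<open>y\<close> lie in \<open>S \<union> {u}\<close>, and \<open>y\<close> has degree less than \<open>2t + 1\<close>
  (\<open>hub_edge_critical_imp_degree_less\<close>).

  From below: a vertex that misses some other vertex is cut off from it by its neighbourhood, so it has
  degree at least \<open>2t\<close> (\<open>nonadjacent_imp_degree_ge\<close>). Every \<open>y \<noteq> u\<close> does miss some vertex: \<open>G\<close> is not
  complete, and if \<open>a, b\<close> are nonadjacent, then \<open>a\<close> has smaller degree than a universal vertex; a
  universal \<open>y \<noteq> u\<close> would therefore give \<open>2t \<le> deg a \<le> deg y - 1 < 2t\<close>.

  So \<open>G - u\<close> is regular of a degree in \<open>[2t - 1, 2t)\<close>, which is 0, 1 or 2 since \<open>2t \<le> 3\<close>.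
  Degree 0 means that \<open>G\<close> is a star, and then \<open>2t \<le> 1\<close>. Otherwise \<open>2t > 1\<close>, and \<open>G - u\<close> is connected,
  since \<open>{u}\<close> as a separator would force \<open>2t \<le> 1\<close>. This excludes degree 1, because a single
  edge plus \<open>u\<close> is complete. In degree 2, where \<open>t > 1\<close>, \<open>G - u\<close> is one cycle
  (\<open>two_regular_connected_cycle\<close>), of length at least 4 since \<open>G\<close> is not complete, and \<open>G\<close> is a wheel.
\<close>

section \<open>Components left by a vertex set\<close>

lemma pair_graph_adj_commute:
  assumes "pair_graph G"
  shows "(x, y) \<in> parcs G \<longleftrightarrow> (y, x) \<in> parcs G"
proof -
  interpret pair_graph G by fact
  show ?thesis using arcs_symmetric by blast
qed

lemma pair_graph_delete_edge:
  assumes "pair_graph G"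
  shows "pair_graph (delete_edge G x y)"
proof -
  interpret pair_graph G by fact
  have sym: "(a, b) \<in> parcs G \<Longrightarrow> (b, a) \<in> parcs G" for a b
    using arcs_symmetric by blast
  show ?thesis
  proof
    show "symmetric (with_proj (delete_edge G x y))"
      by (auto simp: symmetric_def delete_edge_def intro!: symI dest: sym)
  qed (use pair_finite_verts pair_finite_arcs arc_fst_in_verts arc_snd_in_verts pair_no_loops in
      \<open>auto simp: delete_edge_def\<close>)
qed

lemma induce_subgraph_sym_digraph:
  assumes "pair_graph G"
  shows "sym_digraph (with_proj G \<restriction> T)"
proof -
  interpret pair_graph G by fact
  show ?thesis
    by unfold_locales (auto simp: symmetric_conv arcs_symmetric)
qed

lemma components_without_eq_card_scc_of:
  assumes "pair_graph G"
  shows "components_without G S =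
    card (pre_digraph.scc_of (with_proj G \<restriction> (pverts G - S)) ` (pverts G - S))"
proof -
  interpret sym_digraph "with_proj G \<restriction> (pverts G - S)"
    using assms by (rule induce_subgraph_sym_digraph)
  show ?thesis
    unfolding components_without_def num_components_def
    using card_sccs_verts sccs_verts_conv_scc_of by simp
qed

text \<open>
  A path that avoids \<open>S\<close> and starts in \<open>A\<close> stays in \<open>A\<close>, so \<open>x\<close> and \<open>y\<close> lie in different components.
\<close>

lemma components_without_ge2I:
  assumes G: "pair_graph G"
    and A: "A \<subseteq> pverts G - S" "x \<in> A" "y \<in> pverts G - S - A"
    and closed: "\<And>a b. a \<in> A \<Longrightarrow> (a, b) \<in> parcs G \<Longrightarrow> b \<in> A \<union> S"
  shows "2 \<le> components_without G S"
proof -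
  define H where "H = with_proj G \<restriction> (pverts G - S)"
  interpret G: pair_graph G by fact
  interpret H: sym_digraph H
    unfolding H_def using G by (rule induce_subgraph_sym_digraph)
  have "v \<in> A" if "x \<rightarrow>\<^sup>*\<^bsub>H\<^esub> v" for v
    using that
  proof (induction rule: H.reachable_induct)
    case base
    show ?case by (rule A)
  next
    case (step v w)
    then show ?case
      using closed by (auto simp: H_def arcs_ends_conv)
  qed
  then have "y \<notin> H.scc_of x"
    using A by (auto simp: H.scc_of_def)
  moreover have "y \<in> H.scc_of y"
    using A by (intro H.in_scc_of_self) (auto simp: H_def)
  ultimately have "card {H.scc_of x, H.scc_of y} = 2"
    by (metis card_2_iff)
  moreover have "card {H.scc_of x, H.scc_of y} \<le> card (H.scc_of ` (pverts G - S))"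
    using A G.pair_finite_verts by (intro card_mono) auto
  ultimately show ?thesis
    unfolding components_without_eq_card_scc_of[OF G] H_def by simp
qed

text \<open>Each component meets \<open>B\<close>, and a component is determined by any of its vertices.\<close>

lemma components_without_le_card:
  assumes G: "pair_graph G" and "finite B"
    and reach: "\<And>v. v \<in> pverts G - S \<Longrightarrow> \<exists>b\<in>B. v \<rightarrow>\<^sup>*\<^bsub>with_proj G \<restriction> (pverts G - S)\<^esub> b"
  shows "components_without G S \<le> card B"
proof -
  define H where "H = with_proj G \<restriction> (pverts G - S)"
  interpret H: sym_digraph H
    unfolding H_def using G by (rule induce_subgraph_sym_digraph)
  have "H.scc_of ` (pverts G - S) \<subseteq> H.scc_of ` B"
  proof
    fix C assume "C \<in> H.scc_of ` (pverts G - S)"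
    then obtain v where v: "v \<in> pverts G - S" "C = H.scc_of v" by blast
    then obtain b where "b \<in> B" "v \<rightarrow>\<^sup>*\<^bsub>H\<^esub> b"
      using reach unfolding H_def by blast
    then show "C \<in> H.scc_of ` B"
      using v H.scc_of_eq H.scc_ofI_reachable by blast
  qed
  then have "card (H.scc_of ` (pverts G - S)) \<le> card B"
    using \<open>finite B\<close> by (meson surj_card_le)
  then show ?thesis
    unfolding components_without_eq_card_scc_of[OF G] H_def .
qed

section \<open>Toughness as a family of inequalities\<close>

lemma toughness_mult_le:
  assumes "pair_graph G" and "toughness G = ereal t"
    and "S \<subseteq> pverts G" and "2 \<le> components_without G S"
  shows "t * real (components_without G S) \<le> real (card S)"
proof -
  interpret pair_graph G by fact
  have S: "S \<in> separators G"
    using assms by (simp add: separators_def)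
  have "finite (separators G)"
    using pair_finite_verts by (auto simp: separators_def)
  then have "Min ((\<lambda>S. real (card S) / real (components_without G S)) ` separators G)
      \<le> real (card S) / real (components_without G S)"
    using S by simp
  moreover have "t = Min ((\<lambda>S. real (card S) / real (components_without G S)) ` separators G)"
    using assms(2) S by (auto simp: toughness_def split: if_splits)
  ultimately show ?thesis
    using assms(4) by (simp add: pos_le_divide_eq)
qed

lemma toughness_lessE:
  assumes "pair_graph G" and "toughness G < ereal t"
  obtains S where "S \<in> separators G" and "real (card S) < t * real (components_without G S)"
proof -
  interpret pair_graph G by fact
  let ?f = "\<lambda>S. real (card S) / real (components_without G S)"
  have ne: "separators G \<noteq> {}" and less: "Min (?f ` separators G) < t"
    using assms(2) by (auto simp: toughness_def split: if_splits)
  have "finite (separators G)"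
    using pair_finite_verts by (auto simp: separators_def)
  then have "Min (?f ` separators G) \<in> ?f ` separators G"
    using ne by (intro Min_in) auto
  then obtain S where S: "S \<in> separators G" "?f S < t"
    using less by auto
  show thesis
  proof
    show "real (card S) < t * real (components_without G S)"
      using S by (auto simp: separators_def pos_divide_less_eq)
  qed fact
qed

text \<open>Finite toughness needs a separator, and a complete graph has none.\<close>

lemma finite_toughness_imp_nonadjacent:
  assumes G: "pair_graph G" and "toughness G = ereal t"
  shows "\<exists>x \<in> pverts G. \<exists>y \<in> pverts G. x \<noteq> y \<and> (x, y) \<notin> parcs G"
proof (rule ccontr)
  interpret pair_graph G by fact
  assume "\<not> ?thesis"
  then have complete: "(x, y) \<in> parcs G" if "x \<in> pverts G" "y \<in> pverts G" "x \<noteq> y" for x y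
    using that by blast
  obtain S where S: "S \<in> separators G"
    using assms(2) by (auto simp: toughness_def split: if_splits)
  then have "pverts G - S \<noteq> {}"
    using components_without_eq_card_scc_of[OF G, of S] by (auto simp: separators_def)
  then obtain x where x: "x \<in> pverts G - S" by blast
  define H where "H = with_proj G \<restriction> (pverts G - S)"
  interpret H: sym_digraph H
    unfolding H_def using G by (rule induce_subgraph_sym_digraph)
  have verts_H: "verts H = pverts G - S"
    and ends_H: "arcs_ends H = {(v, w) \<in> parcs G. v \<notin> S \<and> w \<notin> S}"
    using wellformed' by (auto simp: H_def arcs_ends_conv)
  have "\<exists>b\<in>{x}. v \<rightarrow>\<^sup>*\<^bsub>H\<^esub> b" if "v \<in> pverts G - S" for v
  proof (cases "v = x")
    case False
    then show ?thesis
      using that x complete[of v x] by (simp add: ends_H H.reachable_adjI)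
  qed (use x in \<open>simp add: verts_H\<close>)
  then have "components_without G S \<le> 1"
    using components_without_le_card[OF G, of "{x}" S] unfolding H_def by simp
  then show False
    using S by (simp add: separators_def)
qed

section \<open>Degrees in a minimally tough graph with a hub\<close>

text \<open>Removing the neighbourhood of \<open>x\<close> isolates \<open>x\<close> while \<open>y\<close> survives elsewhere.\<close>

lemma nonadjacent_imp_degree_ge:
  assumes G: "pair_graph G" and t: "toughness G = ereal t" "0 \<le> t"
    and xy: "x \<in> pverts G" "y \<in> pverts G" "x \<noteq> y" "(x, y) \<notin> parcs G"
  shows "2 * t \<le> real (card (parcs G `` {x}))"
proof -
  interpret pair_graph G by fact
  let ?N = "parcs G `` {x}"
  have "2 \<le> components_without G ?N"
    using G xy no_loops' by (intro components_without_ge2I[where A = "{x}" and x = x and y = y]) auto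
  moreover have "?N \<subseteq> pverts G"
    using in_arcsD2 by blast
  ultimately have "t * real (components_without G ?N) \<le> real (card ?N)" and
    "t * 2 \<le> t * real (components_without G ?N)"
    using G t toughness_mult_le by (auto intro: mult_left_mono)
  then show ?thesis by linarith
qed

text \<open>
  A separator \<open>S\<close> witnessing the loss of toughness spares both ends of the edge, since otherwise it
  would violate the toughness of \<open>G\<close> itself. All survivors except \<open>y\<close> are adjacent to \<open>u\<close>, so there
  are exactly two components, one of which is \<open>y\<close> alone. Thus \<open>S\<close> has fewer than \<open>2t\<close> elements and,
  together with \<open>u\<close>, contains all neighbours of \<open>y\<close>.
\<close>

lemma hub_edge_critical_imp_degree_less:
  assumes G: "pair_graph G" and t: "toughness G = ereal t"
    and u: "universal_vertex G u" and y: "y \<in> pverts G" "y \<noteq> u"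
    and critical: "toughness (delete_edge G u y) < ereal t"
  shows "real (card (parcs G `` {y})) < 2 * t + 1"
proof -
  interpret pair_graph G by fact
  define G' where "G' = delete_edge G u y"
  have G': "pair_graph G'" "pverts G' = pverts G"
    and arcs': "parcs G' = parcs G - {(u, y), (y, u)}"
    using G pair_graph_delete_edge by (auto simp: G'_def delete_edge_def)
  obtain S where S: "S \<in> separators G'" and less: "real (card S) < t * real (components_without G' S)"
    using toughness_lessE[OF G'(1)] critical unfolding G'_def by blast
  have c2: "2 \<le> components_without G' S" and SV: "S \<subseteq> pverts G"
    using S G' by (auto simp: separators_def)
  have out: "u \<notin> S \<and> y \<notin> S"
  proof (rule ccontr)
    assume "\<not> ?thesis"
    then have "with_proj G' \<restriction> (pverts G - S) = with_proj G \<restriction> (pverts G - S)"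
      by (auto simp: induce_subgraph_def arcs')
    then have "components_without G' S = components_without G S"
      by (simp add: components_without_def G')
    then show False
      using toughness_mult_le[OF G t SV] c2 less by simp
  qed
  have uV: "u \<in> pverts G" and hub: "(v, u) \<in> parcs G" if "v \<in> pverts G - {u}" for v
    using u that pair_graph_adj_commute[OF G] by (auto simp: universal_vertex_def)
  define H where "H = with_proj G' \<restriction> (pverts G' - S)"
  interpret H: sym_digraph H
    unfolding H_def using G'(1) by (rule induce_subgraph_sym_digraph)
  have verts_H: "verts H = pverts G - S"
    and ends_H: "arcs_ends H = {(v, w) \<in> parcs G - {(u, y), (y, u)}. v \<notin> S \<and> w \<notin> S}"
    using wellformed' by (auto simp: H_def G' arcs' arcs_ends_conv)
  have reach_u: "v \<rightarrow>\<^sup>*\<^bsub>H\<^esub> u" if "v \<in> pverts G - S" "v \<noteq> y" for v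
  proof (cases "v = u")
    case False
    then show ?thesis
      using that hub[of v] out by (simp add: ends_H H.reachable_adjI)
  qed (use that in \<open>simp add: verts_H\<close>)
  have "\<exists>b\<in>{u, y}. v \<rightarrow>\<^sup>*\<^bsub>H\<^esub> b" if "v \<in> pverts G' - S" for v
    using that reach_u by (cases "v = y") (auto simp: verts_H G')
  then have "components_without G' S \<le> card {u, y}"
    unfolding H_def by (intro components_without_le_card[OF G'(1)]) auto
  then have "components_without G' S = 2"
    using c2 y by simp
  with less have card_S: "real (card S) < 2 * t"
    by simp
  have "parcs G `` {y} \<subseteq> insert u S"
  proof (rule ccontr)
    assume "\<not> ?thesis"
    then obtain z where z: "(y, z) \<in> parcs G" "z \<noteq> u" "z \<notin> S" by blast
    then have zV: "z \<in> pverts G" "z \<noteq> y"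
      using in_arcsD2 no_loops' by auto
    have "y \<rightarrow>\<^bsub>H\<^esub> z"
      using z zV y out by (simp add: ends_H)
    then have "y \<rightarrow>\<^sup>*\<^bsub>H\<^esub> u"
      using reach_u[of z] z zV by (auto intro: H.adj_reachable_trans)
    then have "\<exists>b\<in>{u}. v \<rightarrow>\<^sup>*\<^bsub>H\<^esub> b" if "v \<in> pverts G' - S" for v
      using that reach_u G' by (cases "v = y") auto
    then have "components_without G' S \<le> card {u}"
      unfolding H_def by (intro components_without_le_card[OF G'(1)]) auto
    then show False using c2 by simp
  qed
  moreover have "finite S"
    using SV pair_finite_verts finite_subset by blast
  ultimately have "card (parcs G `` {y}) \<le> card (insert u S)"
    by (intro card_mono) auto
  also have "\<dots> \<le> Suc (card S)"
    by (rule card_insert_le_m1) simp_all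
  finally show ?thesis using card_S by linarith
qed

section \<open>Connected 2-regular relations\<close>

text \<open>
  Walk through \<open>V\<close> without ever turning back. The first repeated vertex must be the starting point,
  because every later vertex already has both of its neighbours on the walk. The vertices visited up
  to then are closed under adjacency, so by connectedness they are all of \<open>V\<close>. Connectedness is stated
  for closed sets, the form in which this last step uses it.
\<close>

lemma two_regular_connected_cycle:
  assumes "finite V" and "V \<noteq> {}" and "R \<subseteq> V \<times> V" and "sym R" and "irrefl R"
    and regular: "\<And>v. v \<in> V \<Longrightarrow> card (R `` {v}) = 2"
    and connected: "\<And>A. A \<subseteq> V \<Longrightarrow> A \<noteq> {} \<Longrightarrow> R `` A \<subseteq> A \<Longrightarrow> A = V"
  obtains p :: "nat \<Rightarrow> 'a" and m where "3 \<le> m" and "bij_betw p {..<m} V"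
    and "\<And>i j. i < m \<Longrightarrow> j < m \<Longrightarrow>
      (p i, p j) \<in> R \<longleftrightarrow> j = (i + 1) mod m \<or> i = (j + 1) mod m"
proof -
  \<comment> \<open>The walk is chosen arc by arc: an arc records the previous vertex, which must be avoided next.\<close>
  have "\<exists>w. \<forall>k. w k \<in> R \<and> (fst (w (Suc k)) = snd (w k) \<and> snd (w (Suc k)) \<noteq> fst (w k))"
  proof (rule dependent_nat_choice)
    obtain v where "v \<in> V" using \<open>V \<noteq> {}\<close> by blast
    then show "\<exists>e. e \<in> R"
      using regular[of v] by (metis Image_singleton_iff card.empty equals0I zero_neq_numeral)
  next
    fix e :: "'a \<times> 'a" and k :: nat
    assume e: "e \<in> R"
    then have "snd e \<in> V"
      using \<open>R \<subseteq> V \<times> V\<close> by auto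
    then have "\<not> R `` {snd e} \<subseteq> {fst e}"
      using regular[of "snd e"] card_mono[of "{fst e}" "R `` {snd e}"] by auto
    then obtain z where "(snd e, z) \<in> R" "z \<noteq> fst e" by auto
    then show "\<exists>e'. e' \<in> R \<and> (fst e' = snd e \<and> snd e' \<noteq> fst e)"
      by (intro exI[of _ "(snd e, z)"]) simp
  qed
  then obtain w where w: "\<And>k. w k \<in> R" "\<And>k. fst (w (Suc k)) = snd (w k)"
    "\<And>k. snd (w (Suc k)) \<noteq> fst (w k)" by blast
  define p where "p k = fst (w k)" for k
  have step: "(p k, p (Suc k)) \<in> R" for k
    using w(1)[of k] by (simp add: p_def w(2))
  have turn: "p (Suc (Suc k)) \<noteq> p k" for k
    using w(3)[of k] by (simp add: p_def w(2))
  have pV: "p k \<in> V" for k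
    using step[of k] \<open>R \<subseteq> V \<times> V\<close> by auto
  have neq: "p (Suc k) \<noteq> p k" for k
    using step[of k] \<open>irrefl R\<close> by (metis irreflD)
  have two: "R `` {v} = {a, b}" if "v \<in> V" "(v, a) \<in> R" "(v, b) \<in> R" "a \<noteq> b" for v a b
  proof -
    have "{a, b} \<subseteq> R `` {v}" "card {a, b} = card (R `` {v})"
      using that regular[of v] by auto
    moreover have "finite (R `` {v})"
      using regular[OF that(1)] card.infinite by fastforce
    ultimately show ?thesis
      using card_subset_eq by metis
  qed
  have nbr: "R `` {p (Suc k)} = {p k, p (Suc (Suc k))}" for k
    using two[OF pV, of "Suc k"] step[of k] step[of "Suc k"] turn[of k] \<open>sym R\<close>
    by (metis symD)

  have "\<exists>m. \<exists>i<m. p i = p m"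
  proof (rule ccontr)
    assume "\<not> ?thesis"
    then have "inj p"
      by (intro linorder_injI) blast
    then show False
      using pV \<open>finite V\<close> by (meson finite_subset image_subsetI range_inj_infinite)
  qed
  then obtain m where m: "\<exists>i<m. p i = p m" and least: "\<And>k. k < m \<Longrightarrow> \<not> (\<exists>i<k. p i = p k)"
    using exists_least_iff[of "\<lambda>m. \<exists>i<m. p i = p m"] by blast
  have inj: "inj_on p {..<m}"
    using least by (intro linorder_inj_onI) auto
  have eq_iff: "p i = p j \<longleftrightarrow> i = j" if "i < m" "j < m" for i j
    using inj that by (auto dest: inj_onD)
  obtain i where i: "i < m" "p i = p m" using m by blast
  \<comment> \<open>At an inner vertex \<open>p i\<close>, the predecessor \<open>p (m - 1)\<close> of \<open>p m\<close> would have to be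
    \<open>p (i - 1)\<close> or \<open>p (i + 1)\<close>: an earlier repetition, a turn back, or a loop.\<close>
  have "i = 0"
  proof (rule ccontr)
    assume "i \<noteq> 0"
    then obtain i' n where i': "i = Suc i'" and n: "m = Suc n"
      using i(1) by (metis not0_implies_Suc not_less0)
    have "(p i, p n) \<in> R"
      using step[of n] i(2) n \<open>sym R\<close> by (metis symD)
    then have "p n = p i' \<or> p n = p (Suc i)"
      using nbr[of i'] i' by auto
    then show False
    proof
      assume "p n = p i'"
      then show False using eq_iff[of n i'] i i' n by auto
    next
      assume *: "p n = p (Suc i)"
      show False
      proof (cases "Suc i < m")
        case True
        then have "n = Suc i" using * eq_iff[of n "Suc i"] n by auto
        then show False using i turn[of i] n by auto
      next
        case False
        then have "Suc i = m" using i by auto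
        then show False using i(2) neq[of i] by auto
      qed
    qed
  qed
  with i have m0: "0 < m" "p m = p 0" by auto
  \<comment> \<open>Returning after one step would be a loop, after two steps a turn back.\<close>
  have "m \<noteq> 1" "m \<noteq> 2"
    using m0 neq[of 0] turn[of 0] by (auto simp: numeral_2_eq_2)
  with m0 have m3: "3 \<le> m" by linarith
  have nbr_mod: "R `` {p i} = {p (if i = 0 then m - 1 else i - 1), p ((i + 1) mod m)}" if "i < m" for i
  proof (cases i)
    case 0
    have "(p 0, p (m - 1)) \<in> R"
      using step[of "m - 1"] m0 \<open>sym R\<close> by (auto dest: symD)
    moreover have "p (m - 1) \<noteq> p 1"
      using eq_iff[of "m - 1" 1] m3 by auto
    ultimately show ?thesis
      using two[OF pV, of 0 "p (m - 1)" "p 1"] step[of 0] m3 0 by auto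
  next
    case (Suc k)
    then show ?thesis
      using nbr[of k] that m0 by (auto simp: mod_Suc)
  qed
  have "p ` {..<m} = V"
  proof (rule connected)
    show "R `` (p ` {..<m}) \<subseteq> p ` {..<m}"
    proof
      fix z assume "z \<in> R `` (p ` {..<m})"
      then obtain i where "i < m" "z \<in> R `` {p i}" by auto
      then have "z = p (if i = 0 then m - 1 else i - 1) \<or> z = p ((i + 1) mod m)"
        using nbr_mod by auto
      moreover have "(if i = 0 then m - 1 else i - 1) < m" "(i + 1) mod m < m"
        using \<open>i < m\<close> by auto
      ultimately show "z \<in> p ` {..<m}" by blast
    qed
  qed (use pV m0 in auto)
  then have bij: "bij_betw p {..<m} V"
    using inj by (simp add: bij_betw_def)
  have adj: "(p i, p j) \<in> R \<longleftrightarrow> j = (i + 1) mod m \<or> i = (j + 1) mod m" if "i < m" "j < m" for i j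
  proof -
    have "(p i, p j) \<in> R \<longleftrightarrow> j = (if i = 0 then m - 1 else i - 1) \<or> j = (i + 1) mod m"
      using nbr_mod[OF that(1)] that eq_iff[of j "if i = 0 then m - 1 else i - 1"]
        eq_iff[of j "(i + 1) mod m"] by (auto simp: set_eq_iff)
    moreover have "j = (if i = 0 then m - 1 else i - 1) \<longleftrightarrow> i = (j + 1) mod m"
      using that by (auto simp: mod_Suc)
    ultimately show ?thesis by blast
  qed
  show thesis
    using that[OF m3 bij adj] .
qed

section \<open>Recognising the wheel\<close>

lemma digraph_iso_with_projI:
  assumes G: "pair_wf_digraph G" and H: "pair_wf_digraph H"
    and bij: "bij_betw g (pverts G) (pverts H)"
    and adj: "\<And>x y. x \<in> pverts G \<Longrightarrow> y \<in> pverts G \<Longrightarrow> (x, y) \<in> parcs G \<longleftrightarrow> (g x, g y) \<in> parcs H"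
  shows "digraph_iso (with_proj G) (with_proj H)"
proof -
  interpret G: pair_wf_digraph G by fact
  interpret H: pair_wf_digraph H by fact
  define hom where "hom = \<lparr>iso_verts = g, iso_arcs = map_prod g g, iso_head = snd, iso_tail = fst\<rparr>"
  have inj: "inj_on g (pverts G)" and img: "g ` pverts G = pverts H"
    using bij by (auto simp: bij_betw_def)
  have "parcs H = map_prod g g ` parcs G"
  proof (intro equalityI subsetI)
    fix e assume e: "e \<in> parcs H"
    then have "fst e \<in> g ` pverts G" "snd e \<in> g ` pverts G"
      using H.arc_fst_in_verts H.arc_snd_in_verts img by auto
    then obtain x y where xy: "x \<in> pverts G" "y \<in> pverts G" "e = (g x, g y)"
      by (metis imageE prod.collapse)
    then show "e \<in> map_prod g g ` parcs G"
      using e adj[of x y] by (auto simp: image_iff intro!: bexI[of _ "(x, y)"])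
  next
    fix e assume "e \<in> map_prod g g ` parcs G"
    then obtain x y where "(x, y) \<in> parcs G" "e = (g x, g y)" by auto
    then show "e \<in> parcs H"
      using adj[of x y] G.in_arcsD1 G.in_arcsD2 by blast
  qed
  moreover have "inj_on (map_prod g g) (parcs G)"
    using map_prod_inj_on[OF inj inj] by (rule inj_on_subset) (auto dest: G.in_arcsD1 G.in_arcsD2)
  ultimately have "pre_digraph.digraph_isomorphism (with_proj G) hom"
    and "with_proj H = app_iso hom (with_proj G)"
    using inj img G.wf_digraph
    by (simp_all add: hom_def pre_digraph.digraph_isomorphism_def app_iso_def with_proj_def)
  then show ?thesis
    unfolding digraph_iso_def by blast
qed

lemma wheel_graph_pverts: "pverts (wheel_graph (Suc m)) = insert (Inl ()) (Inr ` {..<m})"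
  by (auto simp: wheel_graph_def graph_join_def cycle_graph_def)

lemma wheel_graph_parcs:
  "(Inl a, Inl b) \<notin> parcs (wheel_graph (Suc m))"
  "(Inl a, Inr j) \<in> parcs (wheel_graph (Suc m)) \<longleftrightarrow> j < m"
  "(Inr i, Inl b) \<in> parcs (wheel_graph (Suc m)) \<longleftrightarrow> i < m"
  "(Inr i, Inr j) \<in> parcs (wheel_graph (Suc m)) \<longleftrightarrow>
    i < m \<and> j < m \<and> (j = (i + 1) mod m \<or> i = (j + 1) mod m)"
  by (auto simp: wheel_graph_def graph_join_def cycle_graph_def image_iff)

lemma pair_wf_digraph_wheel_graph: "pair_wf_digraph (wheel_graph (Suc m))"
  by unfold_locales (auto simp: wheel_graph_def graph_join_def cycle_graph_def)

lemma hub_plus_cycle_iso_wheel: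
  assumes G: "pair_graph G" and u: "universal_vertex G u"
    and bij: "bij_betw p {..<m} (pverts G - {u})"
    and adj: "\<And>i j. i < m \<Longrightarrow> j < m \<Longrightarrow>
      (p i, p j) \<in> parcs G \<longleftrightarrow> j = (i + 1) mod m \<or> i = (j + 1) mod m"
  shows "digraph_iso (with_proj G) (with_proj (wheel_graph (Suc m)))"
proof -
  interpret pair_graph G by fact
  define q where "q = the_inv_into {..<m} p"
  define g where "g v = (if v = u then Inl () else Inr (q v))" for v
  have q: "bij_betw q (pverts G - {u}) {..<m}"
    unfolding q_def using bij by (rule bij_betw_the_inv_into)
  have q_less: "q v < m" and pq: "p (q v) = v" if "v \<in> pverts G" "v \<noteq> u" for v
    using that bij bij_betwE[OF q] f_the_inv_into_f_bij_betw[OF bij] by (auto simp: q_def)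
  have hub: "(u, v) \<in> parcs G" "(v, u) \<in> parcs G" if "v \<in> pverts G" "v \<noteq> u" for v
    using u that pair_graph_adj_commute[OF G, of u v] by (auto simp: universal_vertex_def)
  show ?thesis
  proof (rule digraph_iso_with_projI)
    show "pair_wf_digraph G" by unfold_locales
    show "bij_betw g (pverts G) (pverts (wheel_graph (Suc m)))"
      unfolding bij_betw_def
    proof
      show "inj_on g (pverts G)"
        using bij_betw_imp_inj_on[OF q] by (auto simp: inj_on_def g_def)
      have "pverts G = insert u (pverts G - {u})"
        using u by (auto simp: universal_vertex_def)
      then have "g ` pverts G = insert (Inl ()) (g ` (pverts G - {u}))"
        by (metis g_def image_insert)
      also have "g ` (pverts G - {u}) = Inr ` q ` (pverts G - {u})"
        by (auto simp: g_def)
      finally show "g ` pverts G = pverts (wheel_graph (Suc m))"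
        using bij_betw_imp_surj_on[OF q] by (simp add: wheel_graph_pverts)
    qed
    fix x y assume xy: "x \<in> pverts G" "y \<in> pverts G"
    have "(x, y) \<in> parcs G \<longleftrightarrow> q y = (q x + 1) mod m \<or> q x = (q y + 1) mod m"
      if "x \<noteq> u" "y \<noteq> u"
      using adj[of "q x" "q y"] q_less pq xy that by simp
    then show "(x, y) \<in> parcs G \<longleftrightarrow> (g x, g y) \<in> parcs (wheel_graph (Suc m))"
      using xy hub no_loops'[of u] q_less by (auto simp: g_def wheel_graph_parcs)
  qed (rule pair_wf_digraph_wheel_graph)
qed

section \<open>The classification\<close>

theorem proposition5p5:
  fixes G :: "'a pair_pre_digraph" and t :: real
  assumes "pair_graph G"
    and "0 < t" and "t \<le> 3/2"
    and "minimally_tough t G"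
    and "\<exists>v. universal_vertex G v"
  shows "(t \<le> 1/2 \<and> (\<exists>l \<ge> 2. complete_bipartite_digraph 1 l (with_proj G))) \<or>
         (t > 1 \<and> (\<exists>l \<ge> 5. digraph_iso (with_proj G) (with_proj (wheel_graph l))))"
proof -
  interpret pair_graph G by fact
  obtain u where u: "universal_vertex G u" using assms by blast
  define V where "V = pverts G - {u}"
  define R where "R = parcs G \<inter> V \<times> V"
  have uV: "u \<in> pverts G" "pverts G = insert u V" "u \<notin> V" "finite V"
    using u pair_finite_verts by (auto simp: universal_vertex_def V_def)
  have t: "toughness G = ereal t"
    using assms(4) by (simp add: minimally_tough_def)
  have hub: "(u, v) \<in> parcs G" "(v, u) \<in> parcs G" if "v \<in> V" for v
    using u that pair_graph_adj_commute[OF assms(1), of u v] by (auto simp: V_def universal_vertex_def)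
  have symR: "sym R"
    using pair_graph_adj_commute[OF assms(1)] by (auto simp: R_def intro: symI)
  have irreflR: "irrefl R"
    using no_loops' by (auto simp: R_def irrefl_def)
  have nbrs: "parcs G `` {y} = insert u (R `` {y})" if "y \<in> V" for y
    using that hub in_arcsD2 uV by (auto simp: R_def)
  have finite_R: "finite (R `` {y})" for y
    using uV(4) by (auto simp: R_def intro: finite_subset[of _ V])
  then have card_nbrs: "card (parcs G `` {y}) = Suc (card (R `` {y}))" if "y \<in> V" for y
    using nbrs[OF that] uV by (auto simp: R_def)

  have upper: "real (card (R `` {y})) < 2 * t" if "y \<in> V" for y
  proof -
    have "toughness (delete_edge G u y) < ereal t"
      using assms(4) hub[OF that] by (auto simp: minimally_tough_def)
    then have "real (card (parcs G `` {y})) < 2 * t + 1"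
      using hub_edge_critical_imp_degree_less[OF assms(1) t u] that by (auto simp: V_def)
    then show ?thesis
      using card_nbrs[OF that] by simp
  qed
  obtain a b where ab: "a \<in> V" "b \<in> V" "a \<noteq> b" "(a, b) \<notin> parcs G"
    using finite_toughness_imp_nonadjacent[OF assms(1) t] hub uV by auto
  have lower: "2 * t \<le> real (card (R `` {y})) + 1" if y: "y \<in> V" for y
  proof -
    have "\<exists>x\<in>V. x \<noteq> y \<and> (y, x) \<notin> parcs G"
    proof (rule ccontr)
      \<comment> \<open>Then \<open>y\<close> is adjacent to all of \<open>V\<close>, so that \<open>a\<close>, which misses \<open>b\<close>, has a smaller degree than
        \<open>y\<close>. But \<open>2t \<le> deg a\<close> and \<open>deg y < 2t + 1\<close> leave no room for that.\<close>
      assume contr: "\<not> ?thesis"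
      then have "R `` {y} = V - {y}"
        using contr y irreflR by (auto simp: R_def irrefl_def)
      then have "card (R `` {y}) = card V - 1"
        using y by simp
      have "R `` {a} \<subseteq> V - {a, b}"
        using ab irreflR by (auto simp: R_def irrefl_def)
      then have "card (R `` {a}) \<le> card V - 2"
        using ab uV(4) card_mono[of "V - {a, b}" "R `` {a}"] by (simp add: card_Diff_subset)
      moreover have "2 * t \<le> real (card (R `` {a})) + 1"
        using nonadjacent_imp_degree_ge[OF assms(1) t _ _ _ ab(3,4)] ab uV assms(2)
          card_nbrs[OF ab(1)] by simp
      moreover have "2 \<le> card V"
        using ab uV(4) card_mono[of V "{a, b}"] by auto
      ultimately show False
        using upper[OF y] \<open>card (R `` {y}) = card V - 1\<close> by simp
    qed
    then obtain x where "x \<in> V" "x \<noteq> y" "(y, x) \<notin> parcs G" by blast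
    then have "2 * t \<le> real (card (parcs G `` {y}))"
      using nonadjacent_imp_degree_ge[OF assms(1) t, of y x] y uV assms(2) by auto
    then show ?thesis
      using card_nbrs[OF y] by simp
  qed

  \<comment> \<open>A proper closed part of \<open>G - u\<close> would make \<open>{u}\<close> a separator leaving at least two components.\<close>
  have connected: "A = V" if "1 < 2 * t" "A \<subseteq> V" "A \<noteq> {}" "R `` A \<subseteq> A" for A
  proof (rule ccontr)
    assume "A \<noteq> V"
    then obtain y where y: "y \<in> V - A"
      using \<open>A \<subseteq> V\<close> by blast
    obtain x where x: "x \<in> A"
      using \<open>A \<noteq> {}\<close> by blast
    have closed: "w \<in> A \<union> {u}" if "v \<in> A" "(v, w) \<in> parcs G" for v w
    proof (cases "w = u")
      case False
      then have "w \<in> V"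
        using that in_arcsD2 by (auto simp: V_def)
      then have "(v, w) \<in> R"
        using that \<open>A \<subseteq> V\<close> by (auto simp: R_def)
      then show ?thesis
        using \<open>R `` A \<subseteq> A\<close> \<open>v \<in> A\<close> by blast
    qed simp
    have c: "2 \<le> components_without G {u}"
      using assms(1)
    proof (rule components_without_ge2I[OF _ _ x _ closed])
      show "A \<subseteq> pverts G - {u}" "y \<in> pverts G - {u} - A"
        using \<open>A \<subseteq> V\<close> y by (auto simp: V_def)
    qed
    then have "t * 2 \<le> t * real (components_without G {u})"
      using assms(2) by (intro mult_left_mono) auto
    also have "\<dots> \<le> 1"
      using toughness_mult_le[OF assms(1) t _ c] uV by simp
    finally show False
      using \<open>1 < 2 * t\<close> by simp
  qed

  consider "2 * t \<le> 1" | "1 < 2 * t" "2 * t \<le> 2" | "2 < 2 * t" by linarith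
  then show ?thesis
  proof cases
    case 1
    have "R `` {y} = {}" if "y \<in> V" for y
    proof -
      have "card (R `` {y}) = 0"
        using upper[OF that] 1 by linarith
      then show ?thesis
        using finite_R by simp
    qed
    then have "R = {}"
      by (auto simp: R_def)
    then have "parcs G = {u} \<times> V \<union> V \<times> {u}"
      using hub uV in_arcsD1 in_arcsD2 no_loops' by (fastforce simp: R_def)
    then have "complete_bipartite_digraph 1 (card V) (with_proj G)"
      unfolding complete_bipartite_digraph_pair_def
      using uV by (intro conjI pair_finite_verts exI[of _ "{u}"] exI[of _ V]) auto
    moreover have "2 \<le> card V"
      using ab uV(4) card_mono[of V "{a, b}"] by auto
    ultimately show ?thesis
      using 1 by auto
  next
    case 2
    \<comment> \<open>The edge at \<open>a\<close> would be all of \<open>G - u\<close>, leaving no room for \<open>b\<close>.\<close>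
    have deg1: "card (R `` {y}) = 1" if "y \<in> V" for y
      using upper[OF that] lower[OF that] 2 by linarith
    obtain c where c: "R `` {a} = {c}"
      using deg1[OF ab(1)] card_1_singletonE by blast
    then have "(a, c) \<in> R" by blast
    then have "c \<in> V" "(c, a) \<in> R"
      using symR by (auto simp: R_def dest: symD)
    then have "R `` {c} = {a}"
      using deg1[of c] by (metis Image_singleton_iff card_1_singletonE singletonD)
    then have "{a, c} = V"
      using c 2 ab \<open>c \<in> V\<close> by (intro connected) auto
    then have "b = c" using ab by auto
    then show ?thesis
      using \<open>(a, c) \<in> R\<close> ab by (auto simp: R_def)
  next
    case 3
    have deg2: "card (R `` {y}) = 2" if "y \<in> V" for y
      using upper[OF that] lower[OF that] 3 assms(3) by linarith
    have ne: "V \<noteq> {}" and sub: "R \<subseteq> V \<times> V"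
      using ab by (auto simp: R_def)
    have conn: "A = V" if "A \<subseteq> V" "A \<noteq> {}" "R `` A \<subseteq> A" for A
      using connected[OF _ that] 3 by simp
    obtain p and m :: nat where "3 \<le> m" and bij: "bij_betw p {..<m} V"
      and adj: "\<And>i j. i < m \<Longrightarrow> j < m \<Longrightarrow> (p i, p j) \<in> R \<longleftrightarrow> j = (i + 1) mod m \<or> i = (j + 1) mod m"
      by (rule two_regular_connected_cycle[OF uV(4) ne sub symR irreflR deg2 conn]) blast+
    \<comment> \<open>The vertex \<open>a\<close>, its two neighbours and \<open>b\<close> show that the cycle is not a triangle.\<close>
    have "card (insert a (insert b (R `` {a}))) \<le> card V"
      using ab uV(4) by (intro card_mono) (auto simp: R_def)
    moreover have "a \<notin> R `` {a}" "b \<notin> R `` {a}"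
      using ab irreflR by (auto simp: R_def irrefl_def)
    then have "card (insert a (insert b (R `` {a}))) = 4"
      using ab(3) deg2[OF ab(1)] finite_R by simp
    moreover have "card V = m"
      using bij_betw_same_card[OF bij] by simp
    ultimately have "5 \<le> Suc m" by simp
    moreover have "digraph_iso (with_proj G) (with_proj (wheel_graph (Suc m)))"
    proof (rule hub_plus_cycle_iso_wheel[OF assms(1) u])
      show "bij_betw p {..<m} (pverts G - {u})"
        using bij by (simp add: V_def)
      show "(p i, p j) \<in> parcs G \<longleftrightarrow> j = (i + 1) mod m \<or> i = (j + 1) mod m" if "i < m" "j < m" for i j
        using adj[OF that] bij_betwE[OF bij] that by (auto simp: R_def)
    qed
    ultimately show ?thesis
      using 3 by (intro disjI2 conjI exI[of _ "Suc m"]) auto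
  qed
qed

end
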